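(* Let $\delta>0$ be a constant, let $\bar{s}$ be an offline string of length $n$ and $s$ an online string of length $n^{\gamma}$ with $\gamma>0$. Consider the following recursive algorithm $\mathcal{A}(s)$ (with $\bar{s}$, $n$ and $\delta$ fixed): if $|s|\le n^{\delta}$, store $s$ entirely, find indices $l,r$ such that $\bar{s}[l,r]$ minimizes $\mathrm{ed}(\bar{s}[l,r],s)$ over all substrings of $\bar{s}$, and return $(l,r,d)$ with $d=\mathrm{ed}(\bar{s}[l,r],s)$. Otherwise set $\xi=n^{\delta}$, split $s$ into $\xi$ consecutive windows $s^*_1,\dots,s^*_\xi$ of equal length $|s|/\xi$, and as each window streams in, apply $\mathcal{A}$ recursively to it, obtaining $(l_i,r_i,d_i)$; then, over all integer tuples $1\le p_0\le p_1\le\dots\le p_\xi\le n+1$, compute $$dist=\sum_{i=1}^{\xi}\Big(d_i+\mathrm{ed}\big(\bar{s}[p_{i-1},p_i),\bar{s}[l_i,r_i]\big)\Big),$$ and return $(l,r,d)=(p_0,\;p_\xi-1,\;\text{the minimum value of }dist)$ for a minimizing tuple. Then the output $(l,r,d)$ of $\mathcal{A}(s)$ is an $O(2^{\gamma/\delta})$-approximation for the closest substring problem, i.e. there is $\alpha=O(2^{\gamma/\delta})$ such that for every substring $\bar{s}[l^*,r^*]$ of $\bar{s}$, $$\mathrm{ed}(\bar{s}[l,r],s)\le d\le \alpha\cdot\mathrm{ed}(\bar{s}[l^*,r^*],s).$$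
   Context: For a string $x$, $x[i,j]$ is the substring from the $i$-th to the $j$-th character and $x[i,j)$ the substring from the $i$-th to the $(j-1)$-th character ($x[i,i)$ is empty). $\mathrm{ed}(x,y)$ is the edit distance (minimum number of insertions, deletions and substitutions transforming $x$ into $y$). The algorithm has random access to $\bar{s}$ and receives $s$ as a stream. The closest substring problem asks for indices $l,r$ and the value $\mathrm{ed}(\bar{s}[l,r],s)$ such that $\bar{s}[l,r]$ has minimum edit distance to $s$ among all substrings of $\bar{s}$. *)

theory Defs
  imports Complex_Main
begin

inductive edit_step :: "'a list \<Rightarrow> 'a list \<Rightarrow> bool" where
  insertion: "edit_step (u @ v) (u @ [a] @ v)"
| deletion: "edit_step (u @ [a] @ v) (u @ v)"
| substitution: "edit_step (u @ [a] @ v) (u @ [b] @ v)"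

definition ed :: "'a list \<Rightarrow> 'a list \<Rightarrow> nat" where
  "ed x y = (LEAST k. (edit_step ^^ k) x y)"

(* x[i,j) and x[i,j], with characters numbered from 1 as in the source *)
definition substr_co :: "'a list \<Rightarrow> nat \<Rightarrow> nat \<Rightarrow> 'a list" where
  "substr_co x i j = take (j - i) (drop (i - 1) x)"

definition substr_cc :: "'a list \<Rightarrow> nat \<Rightarrow> nat \<Rightarrow> 'a list" where
  "substr_cc x i j = substr_co x i (j + 1)"

(* r = l - 1 is allowed and denotes an empty substring: the algorithm may return p_0 = p_\<xi>. *)
definition substr_indices :: "'a list \<Rightarrow> nat \<Rightarrow> nat \<Rightarrow> bool" where
  "substr_indices x l r \<longleftrightarrow> 1 \<le> l \<and> l \<le> r + 1 \<and> r \<le> length x"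

definition closest_substring :: "'a list \<Rightarrow> 'a list \<Rightarrow> nat \<Rightarrow> nat \<Rightarrow> bool" where
  "closest_substring x s l r \<longleftrightarrow> substr_indices x l r \<and>
     (\<forall>l' r'. substr_indices x l' r' \<longrightarrow> ed (substr_cc x l r) s \<le> ed (substr_cc x l' r') s)"

(* Window lengths are |s|/k rounded down or up, so they are all exactly |s|/k if k divides |s|. *)
definition equal_windows :: "nat \<Rightarrow> 'a list \<Rightarrow> 'a list list \<Rightarrow> bool" where
  "equal_windows k s ws \<longleftrightarrow> length ws = k \<and> concat ws = s \<and>
     (\<forall>w\<in>set ws. int (length w) \<in> {\<lfloor>real (length s) / real k\<rfloor>, \<lceil>real (length s) / real k\<rceil>})"

definition cut_tuple :: "nat \<Rightarrow> nat \<Rightarrow> (nat \<Rightarrow> nat) \<Rightarrow> bool" where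
  "cut_tuple n k p \<longleftrightarrow> 1 \<le> p 0 \<and> (\<forall>i<k. p i \<le> p (Suc i)) \<and> p k \<le> n + 1"

(* outs ! i holds the result (l, r, d) for the window with 1-based number i + 1. *)
definition cut_dist :: "'a list \<Rightarrow> (nat \<times> nat \<times> nat) list \<Rightarrow> (nat \<Rightarrow> nat) \<Rightarrow> nat" where
  "cut_dist x outs p = (\<Sum>i<length outs. case outs ! i of (l, r, d) \<Rightarrow>
     d + ed (substr_co x (p i) (p (Suc i))) (substr_cc x l r))"

(* closest_alg \<delta> x s (l, r, d): (l, r, d) is a possible output of the recursive algorithm on
   the online string s, for the offline string x. It is a relation because ties between
   minimizers are broken arbitrarily. n^\<delta> is rounded up to get a number of windows. *)
inductive closest_alg :: "real \<Rightarrow> 'a list \<Rightarrow> 'a list \<Rightarrow> nat \<times> nat \<times> nat \<Rightarrow> bool"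
  for \<delta> :: real and x :: "'a list" where
  base: "\<lbrakk>real (length s) \<le> real (length x) powr \<delta>; closest_substring x s l r\<rbrakk>
    \<Longrightarrow> closest_alg \<delta> x s (l, r, ed (substr_cc x l r) s)"
| split: "\<lbrakk>real (length s) > real (length x) powr \<delta>;
      \<xi> = nat \<lceil>real (length x) powr \<delta>\<rceil>;
      equal_windows \<xi> s ws;
      list_all2 (closest_alg \<delta> x) ws outs;
      cut_tuple (length x) \<xi> p;
      \<And>q. cut_tuple (length x) \<xi> q \<Longrightarrow> cut_dist x outs p \<le> cut_dist x outs q\<rbrakk>
    \<Longrightarrow> closest_alg \<delta> x s (p 0, p \<xi> - 1, cut_dist x outs p)"

lemma concat_of_lengths:
  "sum_list ls = length s \<Longrightarrow> \<exists>ws. concat ws = s \<and> map length ws = ls"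
proof (induction ls arbitrary: s)
  case Nil
  then show ?case by (intro exI[of _ "[]"]) simp
next
  case (Cons k ls)
  then have "sum_list ls = length (drop k s)" by simp
  then obtain ws where ws: "concat ws = drop k s" "map length ws = ls"
    using Cons.IH by blast
  show ?case using ws Cons.prems by (intro exI[of _ "take k s # ws"]) auto
qed

lemma equal_windows_exist:
  assumes "k > 0"
  shows "\<exists>ws. equal_windows k s ws"
proof -
  let ?m = "length s"
  let ?ls = "replicate (?m mod k) (?m div k + 1) @ replicate (k - ?m mod k) (?m div k)"
  have le: "?m mod k < k" using assms by simp
  have "sum_list ?ls = ?m mod k + (?m mod k + (k - ?m mod k)) * (?m div k)"
    unfolding add_mult_distrib by (simp add: sum_list_replicate)
  also have "\<dots> = ?m" using le by simp
  finally obtain ws where ws: "concat ws = s" "map length ws = ?ls"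
    using concat_of_lengths by blast
  have fl: "\<lfloor>real ?m / real k\<rfloor> = int (?m div k)"
    by (simp add: floor_divide_of_nat_eq)
  have ce: "\<lceil>real ?m / real k\<rceil> = int (?m div k) + 1" if "?m mod k > 0"
  proof -
    have "real ?m = real k * real (?m div k) + real (?m mod k)"
      by (metis mult_div_mod_eq of_nat_add of_nat_mult)
    then have "real ?m / real k = real (?m div k) + real (?m mod k) / real k"
      using assms by (simp add: field_simps)
    moreover have "0 < real (?m mod k) / real k" "real (?m mod k) / real k < 1"
      using that le assms by auto
    ultimately show ?thesis by (simp add: ceiling_eq_iff)
  qed
  have "length w = ?m div k \<or> length w = ?m div k + 1 \<and> ?m mod k > 0" if "w \<in> set ws" for w
  proof -
    have "length w \<in> set ?ls" using that ws(2) by (metis image_eqI list.set_map)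
    then show ?thesis by (auto simp: set_replicate_conv_if split: if_splits)
  qed
  moreover have "length ws = k" using arg_cong[OF ws(2), of length] le by simp
  ultimately show ?thesis
    unfolding equal_windows_def using ws(1) fl ce by (intro exI[of _ ws]) fastforce
qed

lemma closest_substring_exists: "\<exists>l r. closest_substring x s l r"
proof -
  have "substr_indices x (fst (1, 0)) (snd (1, 0))" by (simp add: substr_indices_def)
  from ex_has_least_nat[of "\<lambda>z. substr_indices x (fst z) (snd z)", OF this,
      of "\<lambda>z. ed (substr_cc x (fst z) (snd z)) s"]
  show ?thesis unfolding closest_substring_def by fastforce
qed

lemma closest_alg_total:
  fixes x s :: "'a list"
  assumes "\<delta> > 0" "\<gamma> > 0" "real (length s) = real (length x) powr \<gamma>"
  shows "\<exists>out. closest_alg \<delta> x s out"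
proof (cases "length x \<ge> 2")
  case False
  then have "length x = 0 \<or> length x = 1" by linarith
  then have "real (length s) \<le> real (length x) powr \<delta>" using assms by auto
  then show ?thesis using closest_alg.base closest_substring_exists by blast
next
  case True
  let ?k = "nat \<lceil>real (length x) powr \<delta>\<rceil>"
  have gt1: "real (length x) powr \<delta> > 1" using True assms(1) by (intro gr_one_powr) auto
  then have k2: "?k \<ge> 2" by linarith
  show ?thesis
  proof (induction "length s" arbitrary: s rule: less_induct)
    case less
    show ?case
    proof (cases "real (length s) \<le> real (length x) powr \<delta>")
      case True
      then show ?thesis using closest_alg.base closest_substring_exists by blast
    next
      case False
      then have m2: "length s \<ge> 2" using gt1 by linarith
      obtain ws where ws: "equal_windows ?k s ws" using equal_windows_exist[OF order.strict_trans2[OF zero_less_numeral k2]] by blast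
      have "length w < length s" if "w \<in> set ws" for w
      proof -
        have "\<lfloor>real (length s) / real ?k\<rfloor> \<le> \<lceil>real (length s) / real ?k\<rceil>"
          by (rule floor_le_ceiling)
        then have "int (length w) \<le> \<lceil>real (length s) / real ?k\<rceil>"
          using ws that unfolding equal_windows_def by auto
        also have "\<dots> \<le> \<lceil>real (length s) / 2\<rceil>"
          using k2 gt1 by (intro ceiling_mono divide_left_mono) auto
        also have "\<dots> < int (length s)"
          using m2 by linarith
        finally show ?thesis by simp
      qed
      then have "\<forall>w\<in>set ws. \<exists>out. closest_alg \<delta> x w out" using less by blast
      then obtain f where f: "\<forall>w\<in>set ws. closest_alg \<delta> x w (f w)" by metis
      then have outs: "list_all2 (closest_alg \<delta> x) ws (map f ws)"
        by (simp add: list_all2_map2 list_all2_same)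
      have "cut_tuple (length x) ?k (\<lambda>_. 1)" by (simp add: cut_tuple_def)
      from ex_has_least_nat[of "cut_tuple (length x) ?k", OF this, of "cut_dist x (map f ws)"]
      obtain p where "cut_tuple (length x) ?k p"
        "\<And>q. cut_tuple (length x) ?k q \<Longrightarrow> cut_dist x (map f ws) p \<le> cut_dist x (map f ws) q"
        by blast
      then show ?thesis
        using closest_alg.split[OF _ refl ws outs, of p] False by force
    qed
  qed
qed

end

theory Submission imports Defs begin

text \<open>
  Let \<open>\<xi> = \<lceil>n\<^sup>\<delta>\<rceil>\<close>. If \<open>|s| \<le> \<xi>\<^sup>j\<close>, then the recursion on \<open>s\<close> has depth at most \<open>j\<close>: since \<open>\<xi>\<^sup>j\<^sup>-\<^sup>1\<close>
  is an integer, rounding does not push the window length above it. An optimal alignment of a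
  substring of \<open>sbar\<close> with \<open>s\<close> cuts the substring into pieces, one per window, whose edit distances
  \<open>e\<^sub>i\<close> to the windows add up to at most the optimum. Going through the window, the triangle
  inequality bounds the \<open>i\<close>-th summand of the cut by \<open>d\<^sub>i + (e\<^sub>i + d\<^sub>i)\<close>. Hence the
  approximation factors satisfy \<open>c\<^sub>0 = 1\<close> and \<open>c\<^sub>j\<^sub>+\<^sub>1 = 2 c\<^sub>j + 1\<close>, that is, \<open>c\<^sub>j + 1 = 2\<^sup>j\<^sup>+\<^sup>1\<close>, and
  \<open>j = \<lceil>\<gamma>/\<delta>\<rceil>\<close> suffices.
\<close>

section \<open>Edit distance: metric properties and subadditivity under concatenation\<close>

lemma edit_step_append_left: "edit_step x y \<Longrightarrow> edit_step (z @ x) (z @ y)"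
  by (induction rule: edit_step.induct)
    (simp_all only: append_assoc[symmetric, of z] edit_step.intros)

lemma edit_step_append_right: "edit_step x y \<Longrightarrow> edit_step (x @ z) (y @ z)"
  by (induction rule: edit_step.induct) (simp_all only: append_assoc edit_step.intros)

lemma edit_step_sym: "edit_step x y \<Longrightarrow> edit_step y x"
  by (induction rule: edit_step.induct) (rule edit_step.intros)+

lemma edit_steps_append_left: "(edit_step ^^ k) x y \<Longrightarrow> (edit_step ^^ k) (z @ x) (z @ y)"
  by (induction k arbitrary: y) (auto intro: edit_step_append_left)

lemma edit_steps_append_right: "(edit_step ^^ k) x y \<Longrightarrow> (edit_step ^^ k) (x @ z) (y @ z)"
  by (induction k arbitrary: y) (auto intro: edit_step_append_right)

lemma edit_steps_sym: "(edit_step ^^ k) x y \<Longrightarrow> (edit_step ^^ k) y x"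
proof (induction k arbitrary: y)
  case (Suc k)
  then obtain z where "(edit_step ^^ k) x z" "edit_step z y" by auto
  then show ?case using Suc.IH edit_step_sym by (metis relpowp_Suc_I2)
qed auto

lemma edit_steps_to_Nil: "(edit_step ^^ length x) x []"
proof (induction x)
  case (Cons a x)
  have "edit_step (a # x) x" using edit_step.deletion[of "[]" a x] by simp
  then show ?case using Cons by (metis length_Cons relpowp_Suc_I2)
qed simp

lemma edit_steps_trans:
  "(edit_step ^^ k) x y \<Longrightarrow> (edit_step ^^ m) y z \<Longrightarrow> (edit_step ^^ (k + m)) x z"
  by (auto simp: relpowp_add)

text \<open>Deleting all of \<open>x\<close> and then inserting all of \<open>y\<close> is an edit
  sequence, so the \<open>LEAST\<close> in \<open>ed\<close> is attained.\<close>

lemma edit_steps_ed: "(edit_step ^^ ed x y) x y"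
proof -
  have "(edit_step ^^ (length x + length y)) x y"
    using edit_steps_trans[OF edit_steps_to_Nil edit_steps_sym[OF edit_steps_to_Nil]] .
  then show ?thesis unfolding ed_def by (rule LeastI)
qed

lemma ed_le: "(edit_step ^^ k) x y \<Longrightarrow> ed x y \<le> k"
  unfolding ed_def by (rule Least_le)

lemma ed_refl [simp]: "ed x x = 0"
  using ed_le[of 0 x x] by simp

lemma ed_sym: "ed x y = ed y x"
  by (intro order_antisym ed_le edit_steps_sym[OF edit_steps_ed])

lemma ed_triangle: "ed x z \<le> ed x y + ed y z"
  by (intro ed_le edit_steps_trans[of _ x y] edit_steps_ed)

lemma ed_append_le: "ed (u @ v) (a @ b) \<le> ed u a + ed v b"
  by (intro ed_le edit_steps_trans[of _ _ "a @ v"] edit_steps_append_left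
      edit_steps_append_right edit_steps_ed)

lemma ed_concat_le:
  "length us = length ws \<Longrightarrow> ed (concat us) (concat ws) \<le> (\<Sum>i<length ws. ed (us ! i) (ws ! i))"
proof (induction us ws rule: list_induct2)
  case (Cons u us w ws)
  then show ?case
    using ed_append_le[of u "concat us" w "concat ws"]
    by (simp del: sum.lessThan_Suc add: sum.lessThan_Suc_shift)
qed simp

section \<open>Splitting an edit sequence along a concatenation\<close>

text \<open>A step edits a single position, which belongs to \<open>a\<close> or to
  \<open>b\<close>, so it can be undone inside that part alone.\<close>

lemma edit_step_to_append:
  assumes "edit_step z (a @ b)"
  obtains (left) u where "z = u @ b" "edit_step u a"
  | (right) v where "z = a @ v" "edit_step v b"
  using assms
proof cases
  case (insertion u v c)
  from insertion(2) have "(\<exists>t. a @ t = u \<and> b = t @ [c] @ v) \<or> (\<exists>t. a = u @ [c] @ t \<and> t @ b = v)"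
    by (auto simp: append_eq_append_conv2 append_eq_Cons_conv Cons_eq_append_conv)
  then show thesis
    using insertion(1) left right edit_step.insertion by (metis append_assoc)
next
  case (deletion u c v)
  from deletion(2) have "(\<exists>t. a @ t = u \<and> b = t @ v) \<or> (\<exists>t. a = u @ t \<and> t @ b = v)"
    by (auto simp: append_eq_append_conv2)
  then show thesis
    using deletion(1) left right edit_step.deletion by (metis append_assoc)
next
  case (substitution u c v c')
  from substitution(2) have "(\<exists>t. a @ t = u \<and> b = t @ [c'] @ v) \<or> (\<exists>t. a = u @ [c'] @ t \<and> t @ b = v)"
    by (auto simp: append_eq_append_conv2 append_eq_Cons_conv Cons_eq_append_conv)
  then show thesis
    using substitution(1) left right edit_step.substitution by (metis append_assoc)
qed

text \<open>The split of the target is pulled back through the sequence, last step first. Each step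
  touches one part only and adds at most 1 to its distance, by the triangle inequality.\<close>

lemma edit_steps_to_append:
  "(edit_step ^^ k) x (a @ b) \<Longrightarrow> \<exists>u v. x = u @ v \<and> ed u a + ed v b \<le> k"
proof (induction k arbitrary: a b)
  case 0
  then show ?case by (intro exI[of _ a] exI[of _ b]) simp
next
  case (Suc k)
  then obtain z where z: "(edit_step ^^ k) x z" "edit_step z (a @ b)" by auto
  have one: "ed y y' \<le> 1" if "edit_step y y'" for y y' :: "'a list"
    using ed_le[of 1 y y'] that by (simp only: relpowp_1)
  from z(2) show ?case
  proof (cases rule: edit_step_to_append)
    case (left a')
    then obtain u v where "x = u @ v" "ed u a' + ed v b \<le> k" using Suc.IH z(1) by blast
    moreover have "ed u a \<le> ed u a' + 1"
      using ed_triangle[of u a a'] one[OF left(2)] by linarith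
    ultimately show ?thesis by (intro exI[of _ u] exI[of _ v]) simp
  next
    case (right b')
    then obtain u v where "x = u @ v" "ed u a + ed v b' \<le> k" using Suc.IH z(1) by blast
    moreover have "ed v b \<le> ed v b' + 1"
      using ed_triangle[of v b b'] one[OF right(2)] by linarith
    ultimately show ?thesis by (intro exI[of _ u] exI[of _ v]) simp
  qed
qed

text \<open>Windows are peeled off the front, and the last one takes all that is left of
  \<open>x\<close>; this is why at least one window must exist.\<close>

lemma ed_split_concat:
  assumes "ws \<noteq> []"
  shows "\<exists>us. length us = length ws \<and> concat us = x \<and>
    (\<Sum>i<length ws. ed (us ! i) (ws ! i)) \<le> ed x (concat ws)"
  using assms
proof (induction ws arbitrary: x rule: list_nonempty_induct)
  case (single w)
  then show ?case by (intro exI[of _ "[x]"]) simp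
next
  case (cons w ws)
  obtain u v where uv: "x = u @ v" "ed u w + ed v (concat ws) \<le> ed x (concat (w # ws))"
    using edit_steps_to_append[OF edit_steps_ed, of x w "concat ws"] by auto
  obtain us where "length us = length ws" "concat us = v"
    "(\<Sum>i<length ws. ed (us ! i) (ws ! i)) \<le> ed v (concat ws)"
    using cons.IH by blast
  with uv show ?case
    by (intro exI[of _ "u # us"]) (simp del: sum.lessThan_Suc add: sum.lessThan_Suc_shift)
qed

section \<open>Substrings and cut tuples\<close>

lemma substr_co_append:
  assumes "1 \<le> i" "i \<le> j" "j \<le> k"
  shows "substr_co x i j @ substr_co x j k = substr_co x i k"
proof -
  have "k - i = (j - i) + (k - j)" "j - 1 = (j - i) + (i - 1)" using assms by auto
  then show ?thesis unfolding substr_co_def by (simp only: take_add drop_drop)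
qed

text \<open>Relates the returned right end \<open>p \<xi> - 1\<close> to half-open pieces;
  \<open>1 \<le> j\<close> keeps the subtraction from truncating.\<close>

lemma substr_cc_pred: "1 \<le> j \<Longrightarrow> substr_cc x i (j - 1) = substr_co x i j"
  by (simp add: substr_cc_def)

lemma cut_tuple_mono: "cut_tuple n k p \<Longrightarrow> i \<le> j \<Longrightarrow> j \<le> k \<Longrightarrow> p i \<le> p j"
proof (induction j)
  case (Suc j)
  then show ?case by (cases "i = Suc j") (auto simp: cut_tuple_def intro: order_trans)
qed simp

lemma cut_tuple_substr_indices:
  assumes "cut_tuple (length x) k p" "i \<le> j" "j \<le> k"
  shows "substr_indices x (p i) (p j - 1)" "1 \<le> p i"
proof -
  have "p 0 \<le> p i" "p i \<le> p j" "p j \<le> p k"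
    using assms cut_tuple_mono by (metis le_trans zero_le order_refl)+
  then show "substr_indices x (p i) (p j - 1)" "1 \<le> p i"
    using assms(1) by (auto simp: cut_tuple_def substr_indices_def)
qed

lemma concat_cut:
  assumes "cut_tuple (length x) k p" "m \<le> k"
  shows "concat (map (\<lambda>i. substr_co x (p i) (p (Suc i))) [0..<m]) = substr_co x (p 0) (p m)"
  using assms(2)
proof (induction m)
  case 0
  then show ?case by (simp add: substr_co_def)
next
  case (Suc m)
  then show ?case
    using substr_co_append[of "p 0" "p m" "p (Suc m)" x] assms(1)
      cut_tuple_mono[OF assms(1), of 0 m] cut_tuple_mono[OF assms(1), of m "Suc m"]
    by (auto simp: cut_tuple_def)
qed

text \<open>Converse to \<open>concat_cut\<close>: every decomposition of a substring comes from an
  admissible tuple, so the minimum found by the algorithm can be compared with an optimal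
  alignment.\<close>

lemma cut_tuple_of_concat:
  assumes "substr_indices x l r" "concat us = substr_cc x l r"
  obtains p where "cut_tuple (length x) (length us) p"
    "\<And>i. i < length us \<Longrightarrow> substr_co x (p i) (p (Suc i)) = us ! i"
proof
  define p where "p i = l + length (concat (take i us))" for i
  let ?y = "drop (l - 1) x"
  have l: "1 \<le> l" "l \<le> r + 1" "r \<le> length x" using assms(1) by (auto simp: substr_indices_def)
  have y: "concat us = take (r + 1 - l) ?y"
    using assms(2) by (simp add: substr_cc_def substr_co_def)
  have step: "p (Suc i) = p i + length (us ! i)" if "i < length us" for i
    using that by (simp add: p_def take_Suc_conv_app_nth)
  \<comment> \<open>Bounds the last cut by \<open>r + 1\<close>, hence by
    \<open>length x + 1\<close>.\<close>
  have "length (concat us) \<le> r + 1 - l" by (subst y) simp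
  then show "cut_tuple (length x) (length us) p"
    using l step by (auto simp: cut_tuple_def p_def[of 0] p_def[of "length us"])
  show "substr_co x (p i) (p (Suc i)) = us ! i" if i: "i < length us" for i
  proof -
    let ?a = "concat (take i us)" and ?b = "concat (drop (Suc i) us)"
    have "concat us = ?a @ us ! i @ ?b"
      using i by (metis append_take_drop_id concat_append concat.simps(2) Cons_nth_drop_Suc)
    then have "?y = ?a @ us ! i @ ?b @ drop (r + 1 - l) ?y"
      using y by (metis append_assoc append_take_drop_id)
    then have "drop (length ?a) ?y = us ! i @ ?b @ drop (r + 1 - l) ?y"
      by (metis append_eq_conv_conj)
    moreover have "p i - 1 = length ?a + (l - 1)" using l by (simp add: p_def)
    ultimately have "drop (p i - 1) x = us ! i @ ?b @ drop (r + 1 - l) ?y"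
      by (simp add: add.commute)
    then show ?thesis using step[OF i] by (simp add: substr_co_def)
  qed
qed

section \<open>Lower and upper bounds on the returned value\<close>

text \<open>By the triangle inequality through the substring returned for a window, each summand of
  \<open>cut_dist\<close> dominates the distance from the cut piece to that window;
  \<open>ed\<close> is subadditive over the concatenated pieces.\<close>

lemma closest_alg_sound:
  "closest_alg \<delta> x s out \<Longrightarrow>
    case out of (l, r, d) \<Rightarrow> substr_indices x l r \<and> ed (substr_cc x l r) s \<le> d"
proof (induction rule: closest_alg.induct)
  case (base s l r)
  then show ?case by (simp add: closest_substring_def)
next
  case (split s \<xi> ws outs p)
  have len: "length ws = \<xi>" "length outs = \<xi>" "concat ws = s"
    using split by (auto simp: equal_windows_def dest: list_all2_lengthD)
  let ?us = "map (\<lambda>i. substr_co x (p i) (p (Suc i))) [0..<\<xi>]"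
  have le: "ed (?us ! i) (ws ! i) \<le> (case outs ! i of (l, r, d) \<Rightarrow>
      d + ed (substr_co x (p i) (p (Suc i))) (substr_cc x l r))" if "i < \<xi>" for i
  proof -
    obtain l r d where out: "outs ! i = (l, r, d)" by (cases "outs ! i") auto
    then have "ed (substr_cc x l r) (ws ! i) \<le> d"
      using list_all2_nthD[OF split.IH, of i] that len by auto
    then show ?thesis
      using that out ed_triangle[of "?us ! i" "ws ! i" "substr_cc x l r"] by simp
  qed
  have "ed (concat ?us) (concat ws) \<le> (\<Sum>i<\<xi>. ed (?us ! i) (ws ! i))"
    using ed_concat_le[of ?us ws] len by simp
  also have "\<dots> \<le> cut_dist x outs p"
    unfolding cut_dist_def len(2) using le by (intro sum_mono) blast
  finally have "ed (substr_co x (p 0) (p \<xi>)) s \<le> cut_dist x outs p"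
    using concat_cut[OF split.hyps(4), of \<xi>] len by simp
  then show ?case
    using cut_tuple_substr_indices[OF split.hyps(4), of 0 \<xi>]
      cut_tuple_substr_indices(2)[OF split.hyps(4), of \<xi> \<xi>] substr_cc_pred[of "p \<xi>" x "p 0"] by simp
qed

lemma equal_windows_length_le:
  assumes "equal_windows k s ws" "w \<in> set ws" "length s \<le> k * m" "k > 0"
  shows "length w \<le> m"
proof -
  have "real (length s) \<le> real m * real k"
    using assms(3) by (metis mult.commute of_nat_le_iff of_nat_mult)
  then have "real (length s) / real k \<le> real m" using assms(4) by (simp add: divide_le_eq)
  then have "\<lceil>real (length s) / real k\<rceil> \<le> int m" by (simp add: ceiling_le_iff)
  moreover have "\<lfloor>real (length s) / real k\<rfloor> \<le> \<lceil>real (length s) / real k\<rceil>"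
    by (rule floor_le_ceiling)
  moreover have "int (length w) \<in> {\<lfloor>real (length s) / real k\<rfloor>, \<lceil>real (length s) / real k\<rceil>}"
    using assms(1,2) unfolding equal_windows_def by blast
  ultimately have "int (length w) \<le> int m" by (metis insertE order_trans singletonD)
  then show ?thesis by simp
qed

text \<open>The factor is \<open>2 ^ Suc j - 1\<close>; moving one \<open>ed\<close> to the left
  avoids subtraction and turns the recurrence into plain doubling. The substring stays arbitrary in
  the induction because the hypothesis is applied to the pieces of an optimal one.\<close>

lemma closest_alg_approx:
  assumes "closest_alg \<delta> x s out" "real (length x) powr \<delta> \<ge> 1"
    and "length s \<le> nat \<lceil>real (length x) powr \<delta>\<rceil> ^ j" "substr_indices x l' r'"
  shows "snd (snd out) + ed (substr_cc x l' r') s \<le> 2 ^ Suc j * ed (substr_cc x l' r') s"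
  using assms(1,3,4)
proof (induction arbitrary: j l' r' rule: closest_alg.induct)
  case (base s l r)
  let ?e = "ed (substr_cc x l' r') s"
  have "ed (substr_cc x l r) s \<le> ?e" using base by (auto simp: closest_substring_def)
  moreover have "2 * ?e \<le> 2 ^ Suc j * ?e" by simp
  ultimately show ?case unfolding snd_conv by linarith
next
  case (split s \<xi> ws outs p)
  have len: "length ws = \<xi>" "length outs = \<xi>" "concat ws = s"
    using split by (auto simp: equal_windows_def dest: list_all2_lengthD)
  have \<xi>: "\<xi> > 0" using assms(2) split.hyps(2) by linarith
  \<comment> \<open>For \<open>j = 0\<close> the length of \<open>s\<close> would be at most 1, too
    short to be split.\<close>
  obtain m where j: "j = Suc m"
    using split.hyps(1) split.prems(1) assms(2) by (cases j) auto
  have short: "length w \<le> \<xi> ^ m" if "w \<in> set ws" for w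
    using equal_windows_length_le[OF split.hyps(3) that _ \<xi>] split.hyps(2) split.prems(1) j by simp
  have "ws \<noteq> []" using len \<xi> by auto
  then obtain us where us: "length us = \<xi>" "concat us = substr_cc x l' r'"
    "(\<Sum>i<\<xi>. ed (us ! i) (ws ! i)) \<le> ed (substr_cc x l' r') s"
    using ed_split_concat[of ws "substr_cc x l' r'"] len by auto
  obtain q where q: "cut_tuple (length x) \<xi> q"
    "\<And>i. i < \<xi> \<Longrightarrow> substr_co x (q i) (q (Suc i)) = us ! i"
    using cut_tuple_of_concat[OF split.prems(2) us(2)] us(1) by metis
  let ?E = "\<Sum>i<\<xi>. ed (us ! i) (ws ! i)" and ?e = "ed (substr_cc x l' r') s"
  let ?c = "\<lambda>i. case outs ! i of (l, r, d) \<Rightarrow>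
      d + ed (substr_co x (q i) (q (Suc i))) (substr_cc x l r)"
  \<comment> \<open>With \<open>e = ed (us ! i) (ws ! i)\<close>, the left side is at most
    \<open>d + (e + d) + e = 2 * (d + e)\<close>, and the induction hypothesis bounds
    \<open>d + e\<close>.\<close>
  have le: "?c i + ed (us ! i) (ws ! i) \<le> 2 ^ Suc j * ed (us ! i) (ws ! i)" if i: "i < \<xi>" for i
  proof -
    obtain l r d where out: "outs ! i = (l, r, d)" by (cases "outs ! i") auto
    have alg: "closest_alg \<delta> x (ws ! i) (l, r, d)"
      using list_all2_nthD[OF split.IH, of i] i len out by auto
    have sub: "substr_indices x (q i) (q (Suc i) - 1)"
      using cut_tuple_substr_indices(1)[OF q(1), of i "Suc i"] i by simp
    have cc: "substr_cc x (q i) (q (Suc i) - 1) = us ! i"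
      using cut_tuple_substr_indices(2)[OF q(1), of "Suc i" "Suc i"] i q(2)
        substr_cc_pred[of "q (Suc i)" x "q i"] by simp
    have "length (ws ! i) \<le> nat \<lceil>real (length x) powr \<delta>\<rceil> ^ m"
      using short[of "ws ! i"] i len split.hyps(2) by simp
    then have "d + ed (us ! i) (ws ! i) \<le> 2 ^ Suc m * ed (us ! i) (ws ! i)"
      using list_all2_nthD[OF split.IH, of i] i len out sub cc by fastforce
    moreover have "ed (substr_cc x l r) (ws ! i) \<le> d"
      using closest_alg_sound[OF alg] by simp
    moreover have "ed (us ! i) (substr_cc x l r) \<le> ed (us ! i) (ws ! i) + ed (substr_cc x l r) (ws ! i)"
      using ed_triangle[of "us ! i" "substr_cc x l r" "ws ! i"] ed_sym by metis
    ultimately show ?thesis using q(2)[OF i] out j by simp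
  qed
  have "cut_dist x outs p \<le> cut_dist x outs q" using split.hyps(5) q(1) by blast
  moreover have "cut_dist x outs q + ?E \<le> 2 ^ Suc j * ?E"
    unfolding cut_dist_def len(2) sum.distrib[symmetric] sum_distrib_left
    using le by (intro sum_mono) blast
  ultimately have "cut_dist x outs p + ?E \<le> 2 ^ Suc j * ?E" by linarith
  \<comment> \<open>The pieces may cost less than \<open>?e\<close> in total; the slack
    \<open>t\<close> is added on the left and its multiple on the right.\<close>
  moreover obtain t where t: "?e = ?E + t" using us(3) le_Suc_ex by blast
  moreover have "t \<le> 2 ^ Suc j * t" by simp
  ultimately have "cut_dist x outs p + ?e \<le> 2 ^ Suc j * ?e"
    by (simp only: distrib_left)
  then show ?case by simp
qed

lemma closest_alg_ratio:
  assumes "\<gamma> > 0" "\<delta> > 0" "real (length s) = real (length x) powr \<gamma>"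
    and alg: "closest_alg \<delta> x s (l, r, d)" and sub: "substr_indices x l' r'"
  shows "real d \<le> 4 * 2 powr (\<gamma> / \<delta>) * real (ed (substr_cc x l' r') s)"
\<comment> \<open>For empty \<open>x\<close> the power \<open>n^\<delta>\<close> is 0, not at least
  1; then \<open>s\<close> is empty too and only the base case can apply.\<close>
proof (cases "x = []")
  case True
  then have "s = []" using assms(3) by simp
  moreover have "d = ed (substr_cc x l r) s"
    using alg by cases (use True \<open>s = []\<close> in auto)
  ultimately show ?thesis using True by (simp add: substr_cc_def substr_co_def)
next
  case False
  define N where "N = real (length x) powr \<delta>"
  define j where "j = nat \<lceil>\<gamma> / \<delta>\<rceil>"
  let ?e = "ed (substr_cc x l' r') s"
  have N: "N \<ge> 1"
    unfolding N_def using False assms(2) by (intro ge_one_powr_ge_zero) (auto simp: Suc_le_eq)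
  have j: "\<gamma> / \<delta> \<le> real j" "real j \<le> \<gamma> / \<delta> + 1"
    unfolding j_def using assms(1,2) by (auto intro: real_nat_ceiling_ge)
  have "real (length s) = N powr (\<gamma> / \<delta>)"
    using assms(2,3) by (simp add: N_def powr_powr)
  also have "\<dots> \<le> N powr real j" using N j(1) by (intro powr_mono) auto
  also have "\<dots> = N ^ j" using N by (simp add: powr_realpow)
  also have "\<dots> \<le> real (nat \<lceil>N\<rceil>) ^ j"
    using N by (intro power_mono) (auto intro: real_nat_ceiling_ge)
  finally have "length s \<le> nat \<lceil>N\<rceil> ^ j" by (metis of_nat_le_iff of_nat_power)
  then have "d + ?e \<le> 2 ^ Suc j * ?e"
    using closest_alg_approx[OF alg _ _ sub, of j] N unfolding N_def by simp
  then have "real d \<le> real (2 ^ Suc j * ?e)" by linarith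
  also have "\<dots> = 2 powr (real j + 1) * real ?e"
    by (simp add: powr_add powr_realpow)
  \<comment> \<open>The constant 4 arises here: one factor 2 from rounding
    \<open>\<gamma> / \<delta>\<close> up to \<open>j\<close>, the other from the exponent
    \<open>Suc j\<close>.\<close>
  also have "\<dots> \<le> 2 powr (\<gamma> / \<delta> + 2) * real ?e"
    using j(2) by (intro mult_right_mono powr_mono) auto
  also have "\<dots> = 4 * 2 powr (\<gamma> / \<delta>) * real ?e" by (simp add: powr_add)
  finally show ?thesis .
qed

theorem theorem3:
  "\<exists>\<alpha> :: real \<Rightarrow> real \<Rightarrow> real.
     (\<exists>C>0. \<forall>\<gamma>>0. \<forall>\<delta>>0. \<bar>\<alpha> \<gamma> \<delta>\<bar> \<le> C * 2 powr (\<gamma> / \<delta>)) \<and>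
     (\<forall>\<gamma>>0. \<forall>\<delta>>0. \<forall>(sbar :: 'a list) (s :: 'a list) l r d.
        real (length s) = real (length sbar) powr \<gamma> \<longrightarrow>
        closest_alg \<delta> sbar s (l, r, d) \<longrightarrow>
        substr_indices sbar l r \<and>
        (\<forall>l' r'. substr_indices sbar l' r' \<longrightarrow>
           ed (substr_cc sbar l r) s \<le> d \<and>
           real d \<le> \<alpha> \<gamma> \<delta> * real (ed (substr_cc sbar l' r') s)))"
proof (intro exI[of _ "\<lambda>\<gamma> \<delta>. 4 * 2 powr (\<gamma> / \<delta>)"] conjI)
  show "\<exists>C>0. \<forall>\<gamma>>0. \<forall>\<delta>>0. \<bar>4 * 2 powr (\<gamma> / \<delta>)\<bar> \<le> C * 2 powr (\<gamma> / \<delta> :: real)"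
    by (intro exI[of _ 4]) simp
next
  show "\<forall>\<gamma>>0. \<forall>\<delta>>0. \<forall>(sbar :: 'a list) (s :: 'a list) l r d.
        real (length s) = real (length sbar) powr \<gamma> \<longrightarrow>
        closest_alg \<delta> sbar s (l, r, d) \<longrightarrow>
        substr_indices sbar l r \<and>
        (\<forall>l' r'. substr_indices sbar l' r' \<longrightarrow>
           ed (substr_cc sbar l r) s \<le> d \<and>
           real d \<le> 4 * 2 powr (\<gamma> / \<delta>) * real (ed (substr_cc sbar l' r') s))"
    using closest_alg_ratio by (auto dest: closest_alg_sound)
qed

end
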